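(* Let $(X,\rho,\mu)$ be a metric measure space, let $\gamma,\eta\in\mathbb{R}$, $d>0$, $a\in(0,\infty)\setminus\{1\}$, and suppose that a proper open set $D\subset X$ satisfies the domain condition $DC(a,\gamma,d)$. Let $\phi:(0,\infty)\to(0,\infty)$ be a (measurable) function and suppose that for some $H\in(0,1]$ either (i) $a\in(0,1)$, $\eta+\gamma-d>0$ and $\phi\in\mathrm{WLSC}(\eta,0,H)$, or (ii) $a>1$, $\eta+\gamma-d<0$ and $\phi\in\mathrm{WUSC}(\eta,0,H^{-1})$. Then for any $0<p<\infty$ there exist constants $c>0$ and $R>0$ such that $$\int_D\frac{|u(x)|^p}{\phi(\delta_x)}\,\mu(dx)\le c\int_D\int_{D\cap B(x,R\delta_x)}\frac{|u(x)-u(y)|^p}{\phi(\delta_x)\,\delta_x^d}\,\mu(dy)\,\mu(dx)$$ for all measurable functions $u$ on $D$ for which the left-hand side is finite.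
   Context: A metric measure space $(X,\rho,\mu)$ is a metric space $(X,\rho)$ with a Borel measure $\mu$; it is understood that the integrals written make sense (in particular the inner integral is a measurable function of $x$). $B(x,r)$ is the open ball and $\delta_x=\mathrm{dist}(x,X\setminus D)$. Scaling classes: for $\eta\in\mathbb{R}$, $H\in(0,1]$ and $\phi:(0,\infty)\to(0,\infty)$, write $\phi\in\mathrm{WLSC}(\eta,0,H)$ if $\phi(st)\ge Ht^\eta\phi(s)$ for all $s>0$ and all $t\ge1$; write $\phi\in\mathrm{WUSC}(\eta,0,H^{-1})$ if $\phi(st)\ge Ht^\eta\phi(s)$ for all $s>0$ and all $t\in(0,1]$. Domain condition: an open set $D\subset X$ satisfies $DC(a,\gamma,d)$, where $\gamma\in\mathbb{R}$, $d>0$, $a>0$, $a\ne1$, if there exist $M>0$ and (possibly empty, countable) families $\mathcal{B}^{(n)}=\{B^{(n)}_j\}_j$ of (measurable) subsets of $D$, indexed by $n\in\mathbb{Z}$, such that: (B1) $D=\bigcup_{j,n}B^{(n)}_j$, and each $x\in D$ belongs to at most $M$ of the sets $B^{(n)}_j$ (counted over all $j$ and $n$). (B2) For any $B^{(n)}_j$: $M^{-1}a^n\le\delta_x\le Ma^n$ for all $x\in B^{(n)}_j$, and $M^{-1}a^{nd}\le\mu(B^{(n)}_j)\le Ma^{nd}$. (B3) For any $B^{(n)}_j$ and any integer $k>M$ there exists a nonempty finite set $V(B^{(n)}_j,k)$ of indices $i$ (of sets $B^{(n+k)}_i\in\mathcal{B}^{(n+k)}$) such that, for each $i\in V(B^{(n)}_j,k)$,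 $\sup\{\rho(x,y): x\in B^{(n)}_j,\ y\in B^{(n+k)}_i\}$ is at most $Ma^n$ if $a<1$, and at most $Ma^{n+k}$ if $a>1$. (B4) For each $n\in\mathbb{Z}$ and each integer $k>M$, $$\sup_i\sum_{j:\,i\in V(B^{(n)}_j,k)}\frac{1}{\sharp V(B^{(n)}_j,k)}\le Ma^{k\gamma},$$ where $\sharp$ denotes cardinality and $i$ ranges over the indices of $\mathcal{B}^{(n+k)}$. *)

theory Defs
  imports "HOL-Analysis.Analysis"
begin

text \<open>
  The underlying metric space is a type of class \<open>metric_space\<close>, carrying a measure whose
  sigma-algebra is the Borel one. Integrals of nonnegative functions are \<open>ennreal\<close>-valued.
\<close>

definition bdist :: "'a::metric_space set \<Rightarrow> 'a \<Rightarrow> real" where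
  "bdist D x = infdist x (- D)"

definition WLSC :: "real \<Rightarrow> real \<Rightarrow> (real \<Rightarrow> real) \<Rightarrow> bool" where
  "WLSC \<eta> H \<phi> \<longleftrightarrow> (\<forall>s>0. \<forall>t\<ge>1. \<phi> (s * t) \<ge> H * t powr \<eta> * \<phi> s)"

text \<open>
  Written in the form \<open>WUSC(\<eta>, 0, K)\<close>, so that \<open>K = inverse H\<close> gives the factor \<open>H\<close>.
  The middle parameter \<open>0\<close> is dropped here and in \<open>WLSC\<close>: the bounds hold for all \<open>s > 0\<close>.
\<close>

definition WUSC :: "real \<Rightarrow> real \<Rightarrow> (real \<Rightarrow> real) \<Rightarrow> bool" where
  "WUSC \<eta> K \<phi> \<longleftrightarrow> (\<forall>s>0. \<forall>t. 0 < t \<and> t \<le> 1 \<longrightarrow> \<phi> (s * t) \<ge> inverse K * t powr \<eta> * \<phi> s)"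

text \<open>
  The \<open>n\<close>-th family consists of the sets \<open>B n j\<close> with \<open>j \<in> J n\<close>; a countable index set may be
  taken to be a set of natural numbers. \<open>V n j k\<close> is the set of indices attached to \<open>B n j\<close> and
  \<open>k\<close>. The sum in the last condition may be infinite, hence is taken in \<open>ennreal\<close>.
\<close>

definition domain_condition ::
    "'a::metric_space measure \<Rightarrow> 'a set \<Rightarrow> real \<Rightarrow> real \<Rightarrow> real \<Rightarrow> bool" where
  "domain_condition \<mu> D a \<gamma> d \<longleftrightarrow>
    (\<exists>(M::real) (J :: int \<Rightarrow> nat set) (B :: int \<Rightarrow> nat \<Rightarrow> 'a set) (V :: int \<Rightarrow> nat \<Rightarrow> int \<Rightarrow> nat set).
      M > 0 \<and>
      (\<forall>n. \<forall>j\<in>J n. B n j \<in> sets \<mu> \<and> B n j \<subseteq> D) \<and>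
      D = (\<Union>n. \<Union>j\<in>J n. B n j) \<and>
      (\<forall>x\<in>D. finite {(n, j). j \<in> J n \<and> x \<in> B n j} \<and>
              real (card {(n, j). j \<in> J n \<and> x \<in> B n j}) \<le> M) \<and>
      (\<forall>n. \<forall>j\<in>J n.
        (\<forall>x\<in>B n j. inverse M * a powi n \<le> bdist D x \<and> bdist D x \<le> M * a powi n) \<and>
        ennreal (inverse M * a powr (of_int n * d)) \<le> emeasure \<mu> (B n j) \<and>
        emeasure \<mu> (B n j) \<le> ennreal (M * a powr (of_int n * d))) \<and>
      (\<forall>n. \<forall>j\<in>J n. \<forall>k. of_int k > M \<longrightarrow>
        V n j k \<subseteq> J (n + k) \<and> finite (V n j k) \<and> V n j k \<noteq> {} \<and>
        (\<forall>i\<in>V n j k.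
          (SUP (x, y)\<in>B n j \<times> B (n + k) i. ennreal (dist x y))
            \<le> ennreal (if a < 1 then M * a powi n else M * a powi (n + k)))) \<and>
      (\<forall>n k. of_int k > M \<longrightarrow>
        (SUP i\<in>J (n + k).
            \<Sum>\<^sub>\<infinity>j\<in>{j \<in> J n. i \<in> V n j k}. ennreal (1 / real (card (V n j k))))
          \<le> ennreal (M * a powr (of_int k * \<gamma>))))"

definition inner_int ::
    "'a::metric_space measure \<Rightarrow> 'a set \<Rightarrow> (real \<Rightarrow> real) \<Rightarrow> real \<Rightarrow> real \<Rightarrow> real \<Rightarrow> ('a \<Rightarrow> real)
      \<Rightarrow> 'a \<Rightarrow> ennreal" where
  "inner_int \<mu> D \<phi> d p R u x =
    (\<integral>\<^sup>+y\<in>D \<inter> ball x (R * bdist D x).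
       ennreal (\<bar>u x - u y\<bar> powr p / (\<phi> (bdist D x) * bdist D x powr d)) \<partial>\<mu>)"

end

theory Submission
  imports Defs
begin

text \<open>
  The domain is covered, with bounded multiplicity, by cells; those of scale \<open>n\<close> have mass about
  \<open>a powr (n * d)\<close> and lie at a distance about \<open>a powi n\<close> from the boundary. Let
  \<open>w = \<bar>u\<bar> powr p / \<phi> (bdist D)\<close> be the integrand on the left. The idea is to compare \<open>u\<close> on a cell of scale \<open>n\<close> with \<open>u\<close> on cells of scale \<open>n + k\<close>, for one
  large \<open>k\<close> chosen once and for all: closer to the boundary for \<open>a < 1\<close>, farther away for \<open>a > 1\<close>.

  For a cell \<open>P\<close> of scale \<open>n\<close> and a target cell \<open>Q\<close> of scale \<open>n + k\<close>, the quasi-triangle inequality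
  bounds \<open>\<bar>u x\<bar> powr p\<close> for \<open>x \<in> P\<close>, up to a constant, by the average of
  \<open>\<bar>u x - u y\<bar> powr p + \<bar>u y\<bar> powr p\<close> over \<open>y \<in> Q\<close>
  (\<open>local_estimate\<close>). The difference is controlled by the inner integral on the right. In the remaining
  term the integral of \<open>w\<close> over \<open>Q\<close> replaces the one over \<open>P\<close>, at the price of the ratio of the
  masses, about \<open>a powr (- k * d)\<close>, and of the ratio of the weights, at most about \<open>a powr (k * \<eta>)\<close> by the
  scaling of \<open>\<phi>\<close> (\<open>scaling_comparison\<close>).

  Now average over the targets of \<open>P\<close> and sum over all \<open>P\<close>. By the domain condition each \<open>Q\<close> is
  charged by a total of at most a multiple of \<open>a powr (k * \<gamma>)\<close> (\<open>targets_load\<close>), so \<open>sum_le_by_transport\<close> gives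
  \<open>S \<le> right-hand side + C * a powr (k * (\<eta> + \<gamma> - d)) * S\<close>, where \<open>S\<close> is the sum over all cells of the
  integrals of \<open>w\<close> and \<open>C\<close> does not depend on \<open>k\<close>. The hypotheses on the sign of \<open>\<eta> + \<gamma> - d\<close> say
  precisely that the power of \<open>a\<close> tends to \<open>0\<close>, in both cases. For large \<open>k\<close> the factor is below
  \<open>1 / 2\<close>, and as \<open>S\<close> is finite the last term is absorbed into the left-hand side.
\<close>

section \<open>Powers and scaling\<close>

lemma powr_abs_le_two_powr:
  fixes s t p :: real
  assumes "p > 0"
  shows "\<bar>s\<bar> powr p \<le> 2 powr p * (\<bar>s - t\<bar> powr p + \<bar>t\<bar> powr p)"
proof -
  have "\<bar>s\<bar> \<le> 2 * max \<bar>s - t\<bar> \<bar>t\<bar>"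
    by (smt (verit) max.cobounded1 max.cobounded2)
  then have "\<bar>s\<bar> powr p \<le> (2 * max \<bar>s - t\<bar> \<bar>t\<bar>) powr p"
    using assms by (intro powr_mono2) auto
  also have "\<dots> = 2 powr p * max \<bar>s - t\<bar> \<bar>t\<bar> powr p"
    by (simp add: powr_mult)
  also have "max \<bar>s - t\<bar> \<bar>t\<bar> powr p \<le> \<bar>s - t\<bar> powr p + \<bar>t\<bar> powr p"
    by (cases "\<bar>s - t\<bar> \<le> \<bar>t\<bar>") (auto simp: max_def)
  finally show ?thesis
    by simp
qed

text \<open>
  The exponent may have either sign, so both bounds on \<open>t / c\<close> are used; the loss
  \<open>M powr (2 * \<bar>\<eta>\<bar>)\<close> depends only on how far \<open>t\<close> is from \<open>c\<close>, not on \<open>c\<close>.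
\<close>

lemma powr_lower_bound_of_comparable:
  fixes t c M \<eta> :: real
  assumes "1 \<le> M" "0 < c" "c / M\<^sup>2 \<le> t" "t \<le> M\<^sup>2 * c"
  shows "c powr \<eta> / M powr (2 * \<bar>\<eta>\<bar>) \<le> t powr \<eta>"
proof -
  have M: "M > 0" and t: "t > 0"
    using assms by (auto intro: less_le_trans[OF _ assms(3)])
  have "ln (c / M\<^sup>2) \<le> ln t" "ln t \<le> ln (M\<^sup>2 * c)"
    using assms M t by (auto simp: ln_le_cancel_iff)
  then have "\<bar>ln t - ln c\<bar> \<le> 2 * ln M"
    using M assms(2) by (simp add: ln_mult ln_div ln_realpow)
  then have "\<bar>\<eta>\<bar> * \<bar>ln t - ln c\<bar> \<le> \<bar>\<eta>\<bar> * (2 * ln M)"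
    by (intro mult_left_mono) auto
  then have "\<bar>\<eta> * (ln t - ln c)\<bar> \<le> \<bar>\<eta>\<bar> * (2 * ln M)"
    by (simp add: abs_mult)
  then have "\<eta> * ln c - 2 * \<bar>\<eta>\<bar> * ln M \<le> \<eta> * ln t"
    by (simp add: algebra_simps abs_le_iff)
  then show ?thesis
    using M t assms(2) by (simp add: powr_def flip: exp_diff)
qed

text \<open>
  Let \<open>s\<close> and \<open>r\<close> be distances to the boundary from cells of the scales \<open>b\<close> and \<open>b * a ^ k\<close>. Each
  is known only up to the factor \<open>M\<close>, so the ratio \<open>s / r\<close> is comparable to \<open>1 / a ^ k\<close> up to
  \<open>M\<^sup>2\<close>. Once \<open>k\<close> is so large that \<open>a ^ k\<close> outweighs this uncertainty, \<open>s / r\<close> lies on the side of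
  \<open>1\<close> on which the scaling hypothesis speaks: above \<open>1\<close> for \<open>a < 1\<close> and below \<open>1\<close> for \<open>a > 1\<close>. The
  resulting bound has the same form in both cases.
\<close>

lemma scaling_comparison:
  fixes \<phi> :: "real \<Rightarrow> real"
  assumes "0 < a" "a \<noteq> 1" "1 \<le> M" "0 < H"
    and pos: "\<And>s. s > 0 \<Longrightarrow> \<phi> s > 0"
    and scaling: "(a < 1 \<and> WLSC \<eta> H \<phi>) \<or> (a > 1 \<and> WUSC \<eta> (inverse H) \<phi>)"
  shows "\<forall>\<^sub>F k in sequentially. \<forall>b>0. \<forall>s r.
      b / M \<le> s \<and> s \<le> M * b \<and> b * a ^ k / M \<le> r \<and> r \<le> M * (b * a ^ k) \<longrightarrow>
      1 / \<phi> s \<le> M powr (2 * \<bar>\<eta>\<bar>) / H * (a ^ k) powr \<eta> * (1 / \<phi> r)"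
proof -
  define c where "c k = inverse (a ^ k)" for k
  have c: "c k > 0" for k
    using assms by (simp add: c_def)
  have lower: "H * t powr \<eta> * \<phi> r \<le> \<phi> (r * t)"
    if "r > 0" "t > 0" "(a < 1 \<and> t \<ge> 1) \<or> (a > 1 \<and> t \<le> 1)" for r t
    using that scaling by (auto simp: WLSC_def WUSC_def)
  have side: "\<forall>\<^sub>F k in sequentially. (a < 1 \<and> c k / M\<^sup>2 \<ge> 1) \<or> (a > 1 \<and> M\<^sup>2 * c k \<le> 1)"
  proof (cases "a < 1")
    case True
    then have "(\<lambda>k. M\<^sup>2 * a ^ k) \<longlonglongrightarrow> M\<^sup>2 * 0"
      using assms by (intro tendsto_intros LIMSEQ_power_zero) auto
    then have "\<forall>\<^sub>F k in sequentially. M\<^sup>2 * a ^ k < 1"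
      by (rule order_tendstoD) auto
    then show ?thesis
    proof eventually_elim
      case (elim k)
      then show ?case using True assms by (auto simp: c_def field_simps)
    qed
  next
    case False
    then have "(\<lambda>k. M\<^sup>2 * inverse a ^ k) \<longlonglongrightarrow> M\<^sup>2 * 0"
      using assms by (intro tendsto_intros LIMSEQ_power_zero) (auto simp: field_simps)
    then have "\<forall>\<^sub>F k in sequentially. M\<^sup>2 * inverse a ^ k < 1"
      by (rule order_tendstoD) auto
    then show ?thesis
    proof eventually_elim
      case (elim k)
      then show ?case using False assms by (auto simp: c_def power_inverse)
    qed
  qed
  then show ?thesis
  proof eventually_elim
    case (elim k)
    show ?case
    proof (intro allI impI, elim conjE)
      fix b s r :: real
      assume b: "b > 0" and s: "b / M \<le> s" "s \<le> M * b"
        and r: "b * a ^ k / M \<le> r" "r \<le> M * (b * a ^ k)"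
      have ak: "a ^ k > 0" and M: "M > 0"
        using assms by auto
      have "0 < b / M" "0 < b * a ^ k / M"
        using b M ak by auto
      then have sr: "s > 0" "r > 0"
        using s r by linarith+
      define t where "t = s / r"
      have "(b / M) / (M * (b * a ^ k)) \<le> t" unfolding t_def
        using s r sr b M by (intro frac_le) auto
      then have t1: "c k / M\<^sup>2 \<le> t"
        using b M ak by (simp add: c_def field_simps power2_eq_square)
      have "t \<le> (M * b) / (b * a ^ k / M)" unfolding t_def
        using s r sr b M ak by (intro frac_le) auto
      then have t2: "t \<le> M\<^sup>2 * c k"
        using b M ak by (simp add: c_def field_simps power2_eq_square)
      have "(a < 1 \<and> t \<ge> 1) \<or> (a > 1 \<and> t \<le> 1)"
        using elim t1 t2 by auto
      then have "H * t powr \<eta> * \<phi> r \<le> \<phi> s"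
        using lower[of r t] sr by (simp add: t_def)
      moreover have "c k powr \<eta> / M powr (2 * \<bar>\<eta>\<bar>) \<le> t powr \<eta>"
        using powr_lower_bound_of_comparable[OF \<open>1 \<le> M\<close> c t1 t2] .
      ultimately have "H * (c k powr \<eta> / M powr (2 * \<bar>\<eta>\<bar>)) * \<phi> r \<le> \<phi> s"
        using pos[OF \<open>r > 0\<close>] \<open>0 < H\<close>
        by (meson less_imp_le mult_left_mono mult_right_mono order_trans)
      moreover have "c k powr \<eta> = inverse ((a ^ k) powr \<eta>)"
        using ak by (simp add: c_def powr_def ln_inverse exp_minus)
      moreover have "(a ^ k) powr \<eta> > 0" "M powr (2 * \<bar>\<eta>\<bar>) > 0"
        using \<open>0 < a\<close> M by auto
      ultimately show "1 / \<phi> s \<le> M powr (2 * \<bar>\<eta>\<bar>) / H * (a ^ k) powr \<eta> * (1 / \<phi> r)"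
        using pos[OF sr(1)] pos[OF sr(2)] M \<open>0 < H\<close> \<open>0 < a\<close>
        by (simp add: divide_simps mult_ac del: powr_gt_zero)
    qed
  qed
qed

section \<open>Transport of a sum along a sparse relation\<close>

text \<open>
  Countable sums are taken as integrals over counting measure, so that exchanging them with each
  other and with integrals is an instance of one Tonelli theorem. This inequality brings the
  unordered sum of the domain condition into that form.
\<close>

lemma nn_integral_count_space_le_infsum:
  fixes f :: "'i \<Rightarrow> ennreal"
  assumes "countable I"
  shows "(\<integral>\<^sup>+i. f i \<partial>count_space I) \<le> infsum f I"
proof -
  have fin: "sum f F \<le> infsum f I" if "finite F" "F \<subseteq> I" for F
    using that by (auto simp: nonneg_infsum_complete intro!: SUP_upper)
  show ?thesis
  proof (cases "finite I")
    case True
    then show ?thesis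
      using fin[of I] by (simp add: nn_integral_count_space_finite)
  next
    case False
    note bij = bij_betw_from_nat_into[OF assms False]
    have "(\<Sum>n<N. f (from_nat_into I n)) \<le> infsum f I" for N
    proof -
      have "(\<Sum>n<N. f (from_nat_into I n)) = sum f (from_nat_into I ` {..<N})"
        using bij by (subst sum.reindex) (auto simp: bij_betw_def intro: inj_on_subset)
      also have "\<dots> \<le> infsum f I"
        using bij by (intro fin) (auto simp: bij_betw_def)
      finally show ?thesis .
    qed
    then have "(\<Sum>n. f (from_nat_into I n)) \<le> infsum f I"
      by (intro suminf_le_const) auto
    then show ?thesis
      using nn_integral_bij_count_space[OF bij, of f] by (simp add: nn_integral_count_space_nat)
  qed
qed

text \<open>
  If \<open>b P \<le> h P + q * b Q\<close> for each \<open>Q \<in> T P\<close>, then the same holds for the mean over \<open>T P\<close>: the mass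
  of \<open>P\<close> is distributed evenly over its targets. After summation over \<open>P\<close> and interchange of the
  two sums, the factor of \<open>b Q\<close> is the total load that \<open>Q\<close> receives. This is why one
  averages: if a single target were chosen for each index, the loads could be unbounded.
\<close>

lemma sum_le_by_transport:
  fixes b h :: "'i \<Rightarrow> ennreal" and q K :: ennreal
  assumes I: "countable I"
    and T: "\<And>P. P \<in> I \<Longrightarrow> finite (T P) \<and> T P \<noteq> {} \<and> T P \<subseteq> I"
    and step: "\<And>P Q. P \<in> I \<Longrightarrow> Q \<in> T P \<Longrightarrow> b P \<le> h P + q * b Q"
    and load: "\<And>Q. Q \<in> I \<Longrightarrow>
      (\<integral>\<^sup>+P. ennreal (1 / card (T P)) * indicator (T P) Q \<partial>count_space I) \<le> K"
  shows "(\<integral>\<^sup>+P. b P \<partial>count_space I)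
      \<le> (\<integral>\<^sup>+P. h P \<partial>count_space I) + q * K * (\<integral>\<^sup>+P. b P \<partial>count_space I)"
proof -
  \<comment> \<open>the share of the mass of \<open>P\<close> that is sent to \<open>Q\<close>\<close>
  define \<beta> where "\<beta> P Q = ennreal (1 / card (T P)) * indicator (T P) Q" for P Q
  have total: "(\<integral>\<^sup>+Q. \<beta> P Q * c Q \<partial>count_space I) = (\<Sum>Q\<in>T P. ennreal (1 / card (T P)) * c Q)"
    if "P \<in> I" for P and c :: "'i \<Rightarrow> ennreal"
    using T[OF that] by (subst nn_integral_count_space'[of "T P"]) (auto simp: \<beta>_def)
  have unit: "(\<Sum>Q\<in>T P. ennreal (1 / card (T P)) * c) = c" if "P \<in> I" for P c
  proof -
    have "card (T P) > 0"
      using T[OF that] by (simp add: card_gt_0_iff)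
    then have "of_nat (card (T P)) * ennreal (1 / card (T P)) = 1"
      by (simp add: ennreal_of_nat_eq_real_of_nat flip: ennreal_mult)
    then show ?thesis
      by (simp flip: mult.assoc)
  qed
  have avg: "b P \<le> h P + q * (\<integral>\<^sup>+Q. \<beta> P Q * b Q \<partial>count_space I)" if "P \<in> I" for P
  proof -
    have "b P = (\<Sum>Q\<in>T P. ennreal (1 / card (T P)) * b P)"
      using unit[OF that] by simp
    also have "\<dots> \<le> (\<Sum>Q\<in>T P. ennreal (1 / card (T P)) * (h P + q * b Q))"
      using step[OF that] by (intro sum_mono mult_left_mono) auto
    also have "\<dots> = (\<Sum>Q\<in>T P. ennreal (1 / card (T P)) * h P)
        + q * (\<Sum>Q\<in>T P. ennreal (1 / card (T P)) * b Q)"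
      by (simp add: distrib_left sum.distrib sum_distrib_left mult.left_commute)
    finally show ?thesis
      using unit[OF that] total[OF that] by simp
  qed
  have "(\<integral>\<^sup>+P. b P \<partial>count_space I)
      \<le> (\<integral>\<^sup>+P. h P + q * (\<integral>\<^sup>+Q. \<beta> P Q * b Q \<partial>count_space I) \<partial>count_space I)"
    using avg by (intro nn_integral_mono) auto
  also have "\<dots> = (\<integral>\<^sup>+P. h P \<partial>count_space I)
      + q * (\<integral>\<^sup>+P. \<integral>\<^sup>+Q. \<beta> P Q * b Q \<partial>count_space I \<partial>count_space I)"
    by (simp add: nn_integral_add nn_integral_cmult)
  also have "(\<integral>\<^sup>+P. \<integral>\<^sup>+Q. \<beta> P Q * b Q \<partial>count_space I \<partial>count_space I)
      = (\<integral>\<^sup>+Q. \<integral>\<^sup>+P. \<beta> P Q * b Q \<partial>count_space I \<partial>count_space I)"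
    using I by (intro nn_integral_count_space_nn_integral) auto
  also have "\<dots> = (\<integral>\<^sup>+Q. (\<integral>\<^sup>+P. \<beta> P Q \<partial>count_space I) * b Q \<partial>count_space I)"
    by (simp add: nn_integral_multc)
  also have "\<dots> \<le> (\<integral>\<^sup>+Q. K * b Q \<partial>count_space I)"
    using load by (intro nn_integral_mono mult_right_mono) (auto simp: \<beta>_def)
  also have "\<dots> = K * (\<integral>\<^sup>+Q. b Q \<partial>count_space I)"
    by (simp add: nn_integral_cmult)
  finally show ?thesis
    by (simp add: mult.assoc mult_left_mono add_left_mono)
qed

section \<open>Integrals over covers and between two sets\<close>

lemma borel_measurable_times_indicator_subset:
  fixes f :: "'a \<Rightarrow> ennreal"
  assumes f: "f \<in> borel_measurable (restrict_space M D)"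
    and "D \<in> sets M" "A \<in> sets M" "A \<subseteq> D"
  shows "(\<lambda>x. f x * indicator A x) \<in> borel_measurable M"
proof -
  have "(\<lambda>x. f x * indicator D x) \<in> borel_measurable M"
    using assms by (subst borel_measurable_restrict_space_iff_ennreal[symmetric]) auto
  then have "(\<lambda>x. f x * indicator D x * indicator A x) \<in> borel_measurable M"
    using assms(3) by measurable
  also have "(\<lambda>x. f x * indicator D x * indicator A x) = (\<lambda>x. f x * indicator A x)"
    using assms(4) by (auto simp: indicator_def fun_eq_iff)
  finally show ?thesis .
qed

text \<open>
  The sum of the integrals over a cover of \<open>D\<close> is the integral over \<open>D\<close> against the multiplicity of the
  cover, which lies between \<open>1\<close> and \<open>N\<close>.
\<close>

lemma sum_set_nn_integral_bounds:
  fixes f :: "'a \<Rightarrow> ennreal"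
  assumes f: "f \<in> borel_measurable (restrict_space M D)"
    and D: "D \<in> sets M" and I: "countable I"
    and A: "\<And>i. i \<in> I \<Longrightarrow> A i \<in> sets M" and cover: "D = (\<Union>i\<in>I. A i)"
    and overlap: "\<And>x. x \<in> D \<Longrightarrow> finite {i\<in>I. x \<in> A i} \<and> real (card {i\<in>I. x \<in> A i}) \<le> N"
  shows "(\<integral>\<^sup>+x\<in>D. f x \<partial>M) \<le> (\<integral>\<^sup>+i. (\<integral>\<^sup>+x\<in>A i. f x \<partial>M) \<partial>count_space I)"
    and "(\<integral>\<^sup>+i. (\<integral>\<^sup>+x\<in>A i. f x \<partial>M) \<partial>count_space I) \<le> ennreal N * (\<integral>\<^sup>+x\<in>D. f x \<partial>M)"
proof -
  have sub: "A i \<subseteq> D" if "i \<in> I" for i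
    using that cover by auto
  have swap: "(\<integral>\<^sup>+i. (\<integral>\<^sup>+x\<in>A i. f x \<partial>M) \<partial>count_space I)
      = (\<integral>\<^sup>+x. (\<integral>\<^sup>+i. f x * indicator (A i) x \<partial>count_space I) \<partial>M)"
    using I A sub borel_measurable_times_indicator_subset[OF f D]
    by (intro nn_integral_count_space_nn_integral[symmetric]) auto
  have count: "(\<integral>\<^sup>+i. f x * indicator (A i) x \<partial>count_space I)
      = of_nat (card {i\<in>I. x \<in> A i}) * (f x * indicator D x)" if "x \<in> space M" for x
  proof (cases "x \<in> D")
    case True
    then have "(\<integral>\<^sup>+i. f x * indicator (A i) x \<partial>count_space I) = (\<Sum>i\<in>{i\<in>I. x \<in> A i}. f x)"
      using overlap[OF True]
      by (subst nn_integral_count_space'[of "{i\<in>I. x \<in> A i}"]) (auto simp: indicator_def)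
    then show ?thesis
      using True by simp
  next
    case False
    then have "f x * indicator (A i) x = 0" if "i \<in> I" for i
      using sub[OF that] by (auto simp: indicator_def)
    then have "(\<integral>\<^sup>+i. f x * indicator (A i) x \<partial>count_space I) = (\<integral>\<^sup>+i. 0 \<partial>count_space I)"
      by (intro nn_integral_cong) auto
    then show ?thesis
      using False by simp
  qed
  show "(\<integral>\<^sup>+x\<in>D. f x \<partial>M) \<le> (\<integral>\<^sup>+i. (\<integral>\<^sup>+x\<in>A i. f x \<partial>M) \<partial>count_space I)"
    unfolding swap
  proof (intro nn_integral_mono)
    fix x assume x: "x \<in> space M"
    show "f x * indicator D x \<le> (\<integral>\<^sup>+i. f x * indicator (A i) x \<partial>count_space I)"
    proof (cases "x \<in> D")
      case True
      then have "card {i\<in>I. x \<in> A i} > 0"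
        using overlap[OF True] cover by (auto simp: card_gt_0_iff)
      then have "(1::ennreal) \<le> of_nat (card {i\<in>I. x \<in> A i})"
        by (metis One_nat_def Suc_leI of_nat_1 of_nat_mono)
      then have "1 * (f x * indicator D x) \<le> of_nat (card {i\<in>I. x \<in> A i}) * (f x * indicator D x)"
        by (intro mult_right_mono) auto
      then show ?thesis
        by (simp add: count[OF x])
    qed simp
  qed
  have "(\<integral>\<^sup>+x. (\<integral>\<^sup>+i. f x * indicator (A i) x \<partial>count_space I) \<partial>M)
      \<le> (\<integral>\<^sup>+x. ennreal N * (f x * indicator D x) \<partial>M)"
  proof (intro nn_integral_mono)
    fix x assume x: "x \<in> space M"
    show "(\<integral>\<^sup>+i. f x * indicator (A i) x \<partial>count_space I) \<le> ennreal N * (f x * indicator D x)"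
    proof (cases "x \<in> D")
      case True
      then have "of_nat (card {i\<in>I. x \<in> A i}) \<le> ennreal N"
        using overlap[OF True] by (simp add: ennreal_of_nat_eq_real_of_nat ennreal_leI)
      then show ?thesis
        unfolding count[OF x] by (intro mult_right_mono) auto
    qed (simp add: count[OF x])
  qed
  also have "\<dots> = ennreal N * (\<integral>\<^sup>+x\<in>D. f x \<partial>M)"
    using borel_measurable_times_indicator_subset[OF f D D] by (intro nn_integral_cmult) auto
  finally show "(\<integral>\<^sup>+i. (\<integral>\<^sup>+x\<in>A i. f x \<partial>M) \<partial>count_space I) \<le> ennreal N * (\<integral>\<^sup>+x\<in>D. f x \<partial>M)"
    unfolding swap .
qed


text \<open>
  One fixes \<open>x \<in> B\<close> and averages \<open>\<bar>u x\<bar> powr p \<le> 2 powr p * (\<bar>u x - u y\<bar> powr p + \<bar>u y\<bar> powr p)\<close>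
  over \<open>y \<in> B'\<close>. The first term becomes a part of the inner integral at \<open>x\<close>, since \<open>B'\<close> lies in the
  ball around \<open>x\<close> and its mass dominates \<open>bdist D x powr d\<close>. The second is at most a constant times the
  mean of the weighted function over \<open>B'\<close>, which no longer depends on \<open>x\<close>. Hence integrating over \<open>B\<close>
  merely multiplies it by the mass of \<open>B\<close>, and no exchange of integrals takes place. This
  matters because \<open>\<mu>\<close> need not be sigma-finite.
\<close>

lemma local_estimate:
  fixes \<mu> :: "'a::metric_space measure"
  assumes D: "D \<in> sets \<mu>"
    and B: "B \<in> sets \<mu>" "B \<subseteq> D" and B': "B' \<in> sets \<mu>" "B' \<subseteq> D"
    and p: "p > 0" and nonneg: "L \<ge> 0" "\<kappa> \<ge> 0" "\<theta> \<ge> 0"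
    and \<delta>: "\<And>x. x \<in> D \<Longrightarrow> bdist D x > 0" and pos: "\<And>s. s > 0 \<Longrightarrow> \<phi> s > 0"
    and near: "\<And>x y. x \<in> B \<Longrightarrow> y \<in> B' \<Longrightarrow> dist x y < R * bdist D x"
    and m: "emeasure \<mu> B' = ennreal m" "m > 0" "emeasure \<mu> B \<le> ennreal (\<theta> * m)"
    and vol: "\<And>x. x \<in> B \<Longrightarrow> bdist D x powr d \<le> L * m"
    and weight: "\<And>x y. x \<in> B \<Longrightarrow> y \<in> B' \<Longrightarrow> 1 / \<phi> (bdist D x) \<le> \<kappa> * (1 / \<phi> (bdist D y))"
    and u: "u \<in> borel_measurable (restrict_space \<mu> D)"
    and \<phi>: "(\<lambda>x. \<phi> (bdist D x)) \<in> borel_measurable (restrict_space \<mu> D)"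
    and inner: "inner_int \<mu> D \<phi> d p R u \<in> borel_measurable (restrict_space \<mu> D)"
  shows "(\<integral>\<^sup>+x\<in>B. ennreal (\<bar>u x\<bar> powr p / \<phi> (bdist D x)) \<partial>\<mu>)
    \<le> ennreal (2 powr p * L) * (\<integral>\<^sup>+x\<in>B. inner_int \<mu> D \<phi> d p R u x \<partial>\<mu>)
      + ennreal (2 powr p * \<kappa> * \<theta>) * (\<integral>\<^sup>+y\<in>B'. ennreal (\<bar>u y\<bar> powr p / \<phi> (bdist D y)) \<partial>\<mu>)"
proof -
  define w where "w x = \<bar>u x\<bar> powr p / \<phi> (bdist D x)" for x
  define g where "g x y = \<bar>u x - u y\<bar> powr p / (\<phi> (bdist D x) * bdist D x powr d)" for x y
  define W where "W = (\<integral>\<^sup>+y\<in>B'. ennreal (w y) \<partial>\<mu>)"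
  let ?F = "inner_int \<mu> D \<phi> d p R u"
  have w_meas: "(\<lambda>y. ennreal (w y) * indicator B' y) \<in> borel_measurable \<mu>"
    unfolding w_def using u \<phi>
    by (intro borel_measurable_times_indicator_subset[OF _ D B']) measurable
  have g_meas: "(\<lambda>y. ennreal (g x y) * indicator B' y) \<in> borel_measurable \<mu>" for x
    unfolding g_def using u
    by (intro borel_measurable_times_indicator_subset[OF _ D B']
        measurable_compose[OF _ measurable_ennreal]
        borel_measurable_divide powr_real_measurable borel_measurable_abs borel_measurable_diff
        borel_measurable_const)
  have F_meas: "(\<lambda>x. ?F x * indicator B x) \<in> borel_measurable \<mu>"
    by (rule borel_measurable_times_indicator_subset[OF inner D B])
  have split: "ennreal (w x) \<le> ennreal (2 powr p * (L * m)) * ennreal (g x y)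
      + ennreal (2 powr p * \<kappa>) * ennreal (w y)" if "x \<in> B" "y \<in> B'" for x y
  proof -
    have \<phi>x: "\<phi> (bdist D x) > 0" and \<phi>y: "\<phi> (bdist D y) > 0" and dx: "bdist D x powr d > 0"
      using that B B' \<delta>[of x] \<delta>[of y] pos by auto
    have "w x \<le> 2 powr p * (\<bar>u x - u y\<bar> powr p + \<bar>u y\<bar> powr p) / \<phi> (bdist D x)"
      unfolding w_def using powr_abs_le_two_powr[OF p] \<phi>x by (intro divide_right_mono) auto
    also have "\<dots> = 2 powr p * (\<bar>u x - u y\<bar> powr p / \<phi> (bdist D x))
        + 2 powr p * (\<bar>u y\<bar> powr p * (1 / \<phi> (bdist D x)))"
      by (simp add: distrib_left add_divide_distrib)
    also have "\<bar>u x - u y\<bar> powr p / \<phi> (bdist D x) = bdist D x powr d * g x y"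
      using dx by (simp add: g_def)
    also have "\<dots> \<le> L * m * g x y"
      using vol[OF that(1)] \<phi>x by (intro mult_right_mono) (auto simp: g_def)
    also have "\<bar>u y\<bar> powr p * (1 / \<phi> (bdist D x)) \<le> \<bar>u y\<bar> powr p * (\<kappa> * (1 / \<phi> (bdist D y)))"
      using weight[OF that] by (intro mult_left_mono) auto
    also have "\<dots> = \<kappa> * w y"
      by (simp add: w_def)
    finally have "w x \<le> 2 powr p * (L * m) * g x y + 2 powr p * \<kappa> * w y"
      by (simp add: mult.assoc)
    moreover have "g x y \<ge> 0" "w y \<ge> 0"
      using \<phi>x \<phi>y by (auto simp: g_def w_def)
    ultimately show ?thesis
      using nonneg \<open>m > 0\<close> by (simp flip: ennreal_mult ennreal_plus add: ennreal_leI)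
  qed
  have ptw: "ennreal (w x) \<le> ennreal (2 powr p * L) * ?F x + ennreal (2 powr p * \<kappa> / m) * W"
    if x: "x \<in> B" for x
  proof -
    have "ennreal (w x) * ennreal m = (\<integral>\<^sup>+y\<in>B'. ennreal (w x) \<partial>\<mu>)"
      using B' m(1) by (simp add: nn_integral_cmult_indicator)
    also have "\<dots> \<le> (\<integral>\<^sup>+y. ennreal (2 powr p * (L * m)) * (ennreal (g x y) * indicator B' y)
        + ennreal (2 powr p * \<kappa>) * (ennreal (w y) * indicator B' y) \<partial>\<mu>)"
      using split[OF x] by (intro nn_integral_mono) (auto simp: indicator_def)
    also have "\<dots> = ennreal (2 powr p * (L * m)) * (\<integral>\<^sup>+y\<in>B'. ennreal (g x y) \<partial>\<mu>)
        + ennreal (2 powr p * \<kappa>) * W"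
      using w_meas g_meas by (simp add: nn_integral_add nn_integral_cmult W_def)
    also have "(\<integral>\<^sup>+y\<in>B'. ennreal (g x y) \<partial>\<mu>) \<le> ?F x"
      unfolding inner_int_def g_def using B' near[OF x]
      by (intro nn_integral_mono) (auto simp: indicator_def)
    finally have "ennreal (1 / m) * (ennreal (w x) * ennreal m) \<le>
      ennreal (1 / m) * (ennreal (2 powr p * (L * m)) * ?F x + ennreal (2 powr p * \<kappa>) * W)"
      by (simp add: mult_left_mono add_right_mono)
    also have "\<dots> = ennreal (1 / m) * ennreal (2 powr p * (L * m)) * ?F x
        + ennreal (1 / m) * ennreal (2 powr p * \<kappa>) * W"
      by (simp add: distrib_left mult.assoc)
    also have "ennreal (1 / m) * ennreal (2 powr p * (L * m)) = ennreal (2 powr p * L)"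
      using m(2) nonneg by (simp flip: ennreal_mult)
    also have "ennreal (1 / m) * ennreal (2 powr p * \<kappa>) = ennreal (2 powr p * \<kappa> / m)"
      using m(2) nonneg by (simp flip: ennreal_mult)
    also have "ennreal (1 / m) * (ennreal (w x) * ennreal m) = ennreal (w x)"
    proof -
      have "ennreal (1 / m) * ennreal m = 1"
        using m(2) by (simp flip: ennreal_mult)
      then show ?thesis
        by (metis mult.commute mult.left_commute mult.right_neutral)
    qed
    finally show ?thesis .
  qed
  have "(\<integral>\<^sup>+x\<in>B. ennreal (w x) \<partial>\<mu>) \<le> (\<integral>\<^sup>+x. ennreal (2 powr p * L) * (?F x * indicator B x)
      + ennreal (2 powr p * \<kappa> / m) * W * indicator B x \<partial>\<mu>)"
    using ptw by (intro nn_integral_mono) (auto simp: indicator_def)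
  also have "\<dots> = ennreal (2 powr p * L) * (\<integral>\<^sup>+x\<in>B. ?F x \<partial>\<mu>)
      + ennreal (2 powr p * \<kappa> / m) * W * emeasure \<mu> B"
    using F_meas B by (simp add: nn_integral_add nn_integral_cmult nn_integral_cmult_indicator)
  also have "ennreal (2 powr p * \<kappa> / m) * W * emeasure \<mu> B
      \<le> ennreal (2 powr p * \<kappa> / m) * W * ennreal (\<theta> * m)"
    using m(3) by (intro mult_left_mono) auto
  also have "\<dots> = ennreal (2 powr p * \<kappa> / m) * ennreal (\<theta> * m) * W"
    by (simp add: mult_ac)
  also have "ennreal (2 powr p * \<kappa> / m) * ennreal (\<theta> * m) = ennreal (2 powr p * \<kappa> * \<theta>)"
    using m(2) nonneg by (simp flip: ennreal_mult)
  finally show ?thesis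
    by (simp add: w_def W_def add_left_mono)
qed

text \<open>
  Absorption. For \<open>x = \<infinity>\<close> the hypothesis would be void; this is the only place where the finiteness
  of the left-hand side of the Hardy inequality enters.
\<close>

lemma ennreal_le_twice_of_le_add_half:
  fixes x y :: ennreal
  assumes "x < \<infinity>" "x \<le> y + ennreal (1 / 2) * x"
  shows "x \<le> 2 * y"
proof (cases y)
  case (real s)
  obtain r where r: "x = ennreal r" "r \<ge> 0"
    using assms(1) by (cases x) auto
  have "ennreal (1 / 2) * ennreal r = ennreal (r / 2)"
    using r by (subst ennreal_mult[symmetric]) auto
  then have "ennreal r \<le> ennreal (s + r / 2)"
    using assms(2) r real by simp
  then have "r \<le> 2 * s"
    using r real by (subst (asm) ennreal_le_iff) auto
  then have "ennreal r \<le> ennreal (2 * s)"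
    by (rule ennreal_leI)
  then show ?thesis
    using r real by (simp add: ennreal_mult)
qed (simp add: ennreal_mult_top)

section \<open>Covers at all scales\<close>

locale multiscale_cover =
  fixes \<mu> :: "'a::metric_space measure" and D :: "'a set" and a \<gamma> d M :: real
    and J :: "int \<Rightarrow> nat set" and B :: "int \<Rightarrow> nat \<Rightarrow> 'a set" and V :: "int \<Rightarrow> nat \<Rightarrow> int \<Rightarrow> nat set"
  assumes sets_borel: "sets \<mu> = sets borel" and open_D: "open D" and a_pos: "a > 0"
    and d_pos: "d > 0" and M_pos: "M > 0"
    and Bsets: "\<And>n j. j \<in> J n \<Longrightarrow> B n j \<in> sets \<mu> \<and> B n j \<subseteq> D"
    and cover: "D = (\<Union>n. \<Union>j\<in>J n. B n j)"
    and overlap: "\<And>x. x \<in> D \<Longrightarrow> finite {(n, j). j \<in> J n \<and> x \<in> B n j} \<and>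
        real (card {(n, j). j \<in> J n \<and> x \<in> B n j}) \<le> M"
    and Bdist: "\<And>n j x. j \<in> J n \<Longrightarrow> x \<in> B n j \<Longrightarrow>
        inverse M * a powi n \<le> bdist D x \<and> bdist D x \<le> M * a powi n"
    and Bmass: "\<And>n j. j \<in> J n \<Longrightarrow>
        ennreal (inverse M * a powr (of_int n * d)) \<le> emeasure \<mu> (B n j) \<and>
        emeasure \<mu> (B n j) \<le> ennreal (M * a powr (of_int n * d))"
    and Vset: "\<And>n j k. j \<in> J n \<Longrightarrow> of_int k > M \<Longrightarrow>
        V n j k \<subseteq> J (n + k) \<and> finite (V n j k) \<and> V n j k \<noteq> {}"
    and Vdist: "\<And>n j k i. j \<in> J n \<Longrightarrow> of_int k > M \<Longrightarrow> i \<in> V n j k \<Longrightarrow>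
        (SUP (x, y)\<in>B n j \<times> B (n + k) i. ennreal (dist x y))
          \<le> ennreal (if a < 1 then M * a powi n else M * a powi (n + k))"
    and Vload: "\<And>n k. of_int k > M \<Longrightarrow>
        (SUP i\<in>J (n + k). \<Sum>\<^sub>\<infinity>j\<in>{j \<in> J n. i \<in> V n j k}. ennreal (1 / real (card (V n j k))))
          \<le> ennreal (M * a powr (of_int k * \<gamma>))"
begin

lemma powi_pos: "a powi n > 0"
  using a_pos by simp

lemma bdist_pos:
  assumes "x \<in> D"
  shows "bdist D x > 0"
proof -
  from assms obtain n j where j: "j \<in> J n" "x \<in> B n j"
    using cover by auto
  have "0 < inverse M * a powi n"
    using powi_pos M_pos by simp
  also have "\<dots> \<le> bdist D x"
    using Bdist[OF j] by simp
  finally show ?thesis .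
qed

text \<open>
  The two-sided bounds on the distance contradict each other for \<open>M < 1\<close> as soon as one cell has a
  point.
\<close>

lemma one_le_M:
  assumes "D \<noteq> {}"
  shows "M \<ge> 1"
proof (rule ccontr)
  assume M: "\<not> M \<ge> 1"
  from assms obtain x n j where "j \<in> J n" "x \<in> B n j"
    using cover by auto
  then have "inverse M * a powi n \<le> M * a powi n"
    using Bdist by force
  then have "inverse M \<le> M"
    using powi_pos[of n] by simp
  moreover have "1 < inverse M"
    using M M_pos by (simp add: one_less_inverse)
  ultimately show False
    using M by simp
qed

lemma D_sets: "D \<in> sets \<mu>"
  using sets_borel open_D by simp

lemma weight_measurable:
  fixes \<phi> :: "real \<Rightarrow> real"
  assumes "\<phi> \<in> borel_measurable (restrict_space borel {0<..})"
  shows "(\<lambda>x. \<phi> (bdist D x)) \<in> borel_measurable (restrict_space \<mu> D)"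
proof -
  have "bdist D \<in> borel_measurable borel"
    unfolding bdist_def by (intro borel_measurable_continuous_onI continuous_intros)
  then have "bdist D \<in> borel_measurable \<mu>"
    using sets_borel by (simp cong: measurable_cong_sets)
  then have "bdist D \<in> measurable (restrict_space \<mu> D) (restrict_space borel {0<..})"
    using bdist_pos by (intro measurable_restrict_space2 measurable_restrict_space1)
      (auto simp: space_restrict_space)
  from measurable_compose[OF this assms] show ?thesis .
qed

text \<open>
  Cells of all scales are indexed by one set of pairs. The passage from scale \<open>n\<close> to
  scale \<open>n + k\<close> then stays within a single index set, and the sums over all scales on the two
  sides of the estimate are literally the same number.
\<close>

definition cell_indices :: "(int \<times> nat) set" where "cell_indices = Sigma UNIV J"

definition cell :: "int \<times> nat \<Rightarrow> 'a set" where "cell P = B (fst P) (snd P)"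

definition targets :: "nat \<Rightarrow> int \<times> nat \<Rightarrow> (int \<times> nat) set" where
  "targets k P = Pair (fst P + int k) ` V (fst P) (snd P) (int k)"

lemma countable_cell_indices: "countable cell_indices"
  by (rule countableI_type)

lemma cell_sets: "P \<in> cell_indices \<Longrightarrow> cell P \<in> sets \<mu>"
  and cell_subset: "P \<in> cell_indices \<Longrightarrow> cell P \<subseteq> D"
  using Bsets[of "snd P" "fst P"] by (auto simp: cell_indices_def cell_def)

lemma cell_cover: "D = (\<Union>P\<in>cell_indices. cell P)"
proof -
  have "(\<Union>P\<in>cell_indices. cell P) = (\<Union>n. \<Union>j\<in>J n. B n j)"
    by (force simp: cell_indices_def cell_def)
  then show ?thesis
    using cover by simp
qed

lemma cell_overlap:
  "x \<in> D \<Longrightarrow> finite {P \<in> cell_indices. x \<in> cell P} \<and>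
    real (card {P \<in> cell_indices. x \<in> cell P}) \<le> M"
proof -
  have "{P \<in> cell_indices. x \<in> cell P} = {(n, j). j \<in> J n \<and> x \<in> B n j}"
    by (auto simp: cell_indices_def cell_def)
  then show "x \<in> D \<Longrightarrow> ?thesis"
    using overlap by simp
qed

lemma targets_nonempty_finite:
  assumes "real k > M" "P \<in> cell_indices"
  shows "finite (targets k P) \<and> targets k P \<noteq> {} \<and> targets k P \<subseteq> cell_indices"
  using Vset[of "snd P" "fst P" "int k"] assms by (auto simp: cell_indices_def targets_def)

lemma card_targets: "card (targets k P) = card (V (fst P) (snd P) (int k))"
  unfolding targets_def by (intro card_image) (auto simp: inj_on_def)

text \<open>
  Only cells of the one scale \<open>n\<close> have targets of scale \<open>n + k\<close>, so the sum over all pairs collapses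
  to the sum over \<open>j\<close> that the domain condition controls.
\<close>

lemma targets_load:
  assumes k: "real k > M" and "Q \<in> cell_indices"
  shows "(\<integral>\<^sup>+P. ennreal (1 / card (targets k P)) * indicator (targets k P) Q \<partial>count_space cell_indices)
    \<le> ennreal (M * (a ^ k) powr \<gamma>)"
proof -
  obtain n i where Q: "Q = (n + int k, i)"
    by (metis diff_add_cancel surj_pair)
  then have i: "i \<in> J (n + int k)"
    using assms(2) by (simp add: cell_indices_def)
  define S where "S = {j \<in> J n. i \<in> V n j (int k)}"
  have S: "Pair n ` S \<subseteq> cell_indices"
    by (auto simp: S_def cell_indices_def)
  have "(\<integral>\<^sup>+P. ennreal (1 / card (targets k P)) * indicator (targets k P) Q \<partial>count_space cell_indices)
      = (\<integral>\<^sup>+P. ennreal (1 / card (targets k P)) * indicator (targets k P) Q \<partial>count_space (Pair n ` S))"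
    using S by (intro nn_integral_count_space_eq)
      (auto simp: Q S_def cell_indices_def targets_def indicator_def image_iff)
  also have "\<dots> = (\<integral>\<^sup>+j. ennreal (1 / card (targets k (n, j))) * indicator (targets k (n, j)) Q \<partial>count_space S)"
    by (rule nn_integral_bij_count_space[symmetric]) (auto simp: bij_betw_def inj_on_def)
  also have "\<dots> = (\<integral>\<^sup>+j. ennreal (1 / card (V n j (int k))) \<partial>count_space S)"
    by (intro nn_integral_cong, unfold card_targets) (auto simp: Q targets_def S_def indicator_def)
  also have "\<dots> \<le> (\<Sum>\<^sub>\<infinity>j\<in>S. ennreal (1 / card (V n j (int k))))"
    by (intro nn_integral_count_space_le_infsum) auto
  also have "\<dots> \<le> ennreal (M * a powr (of_int (int k) * \<gamma>))"
    unfolding S_def using k by (intro order_trans[OF SUP_upper[OF i] Vload]) simp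
  also have "M * a powr (of_int (int k) * \<gamma>) = M * (a ^ k) powr \<gamma>"
    using a_pos by (simp add: powr_powr flip: powr_realpow)
  finally show ?thesis .
qed

lemma power_int_shift: "a powi (n + int k) = a powi n * a ^ k"
  using a_pos by (simp add: power_int_add)

lemma powr_mult_exponent: "a powr (of_int n * d) = (a powi n) powr d"
  using a_pos by (simp add: powr_powr flip: powr_real_of_int')

text \<open>
  The local estimate between a cell and one of its targets. Masses and distances are expressed
  through the scale \<open>\<alpha> = a powi n\<close> of the source cell and cancel, so that the constants depend only
  on \<open>k\<close>. In \<open>R\<close>, the maximum covers both normalisations of the distance between cells
  (\<open>M * \<alpha>\<close> for \<open>a < 1\<close> and \<open>M * \<alpha> * a ^ k\<close> for \<open>a > 1\<close>), one factor \<open>M\<close> turns \<open>\<alpha>\<close> into the distance to the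
  boundary, and the summand \<open>1\<close> makes the inequality strict, as the ball is open.
\<close>

lemma transport_step:
  fixes \<phi> u :: "_ \<Rightarrow> real" and k :: nat
  defines "R \<equiv> M\<^sup>2 * max 1 (a ^ k) + 1"
    and "L \<equiv> M powr d * M * (a ^ k) powr - d"
    and "\<theta> \<equiv> M\<^sup>2 * (a ^ k) powr - d"
  assumes k: "real k > M" and P: "P \<in> cell_indices" and Q: "Q \<in> targets k P"
    and p: "p > 0" and \<kappa>: "\<kappa> \<ge> 0" and pos: "\<And>s. s > 0 \<Longrightarrow> \<phi> s > 0"
    and \<phi>_meas: "\<phi> \<in> borel_measurable (restrict_space borel {0<..})"
    and comparison: "\<And>b s r. b > 0 \<Longrightarrow> b / M \<le> s \<Longrightarrow> s \<le> M * b \<Longrightarrow>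
        b * a ^ k / M \<le> r \<Longrightarrow> r \<le> M * (b * a ^ k) \<Longrightarrow> 1 / \<phi> s \<le> \<kappa> * (1 / \<phi> r)"
    and u: "u \<in> borel_measurable (restrict_space \<mu> D)"
    and inner: "inner_int \<mu> D \<phi> d p R u \<in> borel_measurable (restrict_space \<mu> D)"
  shows "(\<integral>\<^sup>+x\<in>cell P. ennreal (\<bar>u x\<bar> powr p / \<phi> (bdist D x)) \<partial>\<mu>)
    \<le> ennreal (2 powr p * L) * (\<integral>\<^sup>+x\<in>cell P. inner_int \<mu> D \<phi> d p R u x \<partial>\<mu>)
      + ennreal (2 powr p * \<kappa> * \<theta>) * (\<integral>\<^sup>+y\<in>cell Q. ennreal (\<bar>u y\<bar> powr p / \<phi> (bdist D y)) \<partial>\<mu>)"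
proof -
  have ak: "a ^ k > 0"
    using a_pos by simp
  have QI: "Q \<in> cell_indices"
    using targets_nonempty_finite[OF k P] Q by auto
  obtain n j where Pnj: "P = (n, j)" by force
  obtain i where i: "Q = (n + int k, i)" "i \<in> V n j (int k)"
    using Q by (auto simp: targets_def Pnj)
  have j: "j \<in> J n" and i': "i \<in> J (n + int k)"
    using P targets_nonempty_finite[OF k P] Q by (auto simp: cell_indices_def Pnj i)
  have AP: "cell P = B n j" and AQ: "cell Q = B (n + int k) i"
    by (simp_all add: cell_def Pnj i)
  define \<alpha> where "\<alpha> = a powi n"
  have \<alpha>: "\<alpha> > 0" using powi_pos by (simp add: \<alpha>_def)
  have dP: "\<alpha> / M \<le> bdist D x" "bdist D x \<le> M * \<alpha>" if "x \<in> cell P" for x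
    using Bdist[OF j, of x] that by (auto simp: AP \<alpha>_def field_simps)
  have dQ: "\<alpha> * a ^ k / M \<le> bdist D y" "bdist D y \<le> M * (\<alpha> * a ^ k)" if "y \<in> cell Q" for y
    using Bdist[OF i', of y] that by (auto simp: AQ \<alpha>_def power_int_shift field_simps)
  define m where "m = measure \<mu> (cell Q)"
  have mQ: "ennreal ((\<alpha> * a ^ k) powr d / M) \<le> emeasure \<mu> (cell Q)"
      "emeasure \<mu> (cell Q) \<le> ennreal (M * (\<alpha> * a ^ k) powr d)"
    using Bmass[OF i'] unfolding powr_mult_exponent power_int_shift
    by (auto simp: AQ \<alpha>_def divide_inverse mult.commute)
  \<comment> \<open>both bounds matter: finite mass allows an average over \<open>cell Q\<close>, positive mass a division by it\<close>
  then have m: "emeasure \<mu> (cell Q) = ennreal m"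
    unfolding m_def by (intro emeasure_eq_ennreal_measure) (auto simp: top_unique)
  have m_lower: "(\<alpha> * a ^ k) powr d / M \<le> m"
    using mQ(1) by (simp add: m m_def)
  have m_pos: "m > 0"
    using \<alpha> a_pos M_pos by (intro less_le_trans[OF _ m_lower]) auto
  have \<alpha>m: "\<alpha> powr d \<le> M * (a ^ k) powr - d * m"
    using m_lower \<alpha> a_pos M_pos by (simp add: powr_mult powr_minus field_simps)
  show ?thesis
  proof (rule local_estimate)
    show "emeasure \<mu> (cell P) \<le> ennreal (\<theta> * m)"
    proof -
      have "emeasure \<mu> (cell P) \<le> ennreal (M * \<alpha> powr d)"
        using Bmass[OF j] by (simp add: AP \<alpha>_def powr_mult_exponent)
      also have "M * \<alpha> powr d \<le> \<theta> * m"
        using mult_left_mono[OF \<alpha>m, of M] M_pos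
        by (simp add: \<theta>_def power2_eq_square mult_ac)
      finally show ?thesis by (simp add: ennreal_leI)
    qed
    show "dist x y < R * bdist D x" if "x \<in> cell P" "y \<in> cell Q" for x y
    proof -
      let ?r = "if a < 1 then M * a powi n else M * a powi (n + int k)"
      have "ennreal (dist x y) \<le> (SUP (x, y)\<in>cell P \<times> cell Q. ennreal (dist x y))"
        using that by (intro SUP_upper2[of "(x, y)"]) auto
      also have "\<dots> \<le> ennreal ?r"
        using Vdist[OF j _ i(2)] k by (simp add: AP AQ)
      finally have "dist x y \<le> ?r"
        using M_pos powi_pos by (subst (asm) ennreal_le_iff) (auto simp: less_imp_le)
      also have "?r \<le> M * \<alpha> * max 1 (a ^ k)"
        using M_pos \<alpha> by (auto simp: power_int_shift \<alpha>_def mult.assoc)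
      also have "\<dots> \<le> M * (M * bdist D x) * max 1 (a ^ k)"
        using dP(1)[OF that(1)] M_pos
        by (intro mult_right_mono mult_left_mono) (auto simp: field_simps)
      also have "\<dots> < R * bdist D x"
        using bdist_pos[of x] cell_subset[OF P] that(1)
        by (auto simp: R_def power2_eq_square algebra_simps)
      finally show ?thesis .
    qed
    show "bdist D x powr d \<le> L * m" if "x \<in> cell P" for x
    proof -
      have "bdist D x powr d \<le> (M * \<alpha>) powr d"
        using dP[OF that] d_pos bdist_pos[of x] cell_subset[OF P] that
        by (intro powr_mono2) (auto simp: less_imp_le)
      also have "\<dots> \<le> M powr d * (M * (a ^ k) powr - d * m)"
        using \<alpha>m by (simp add: powr_mult mult_left_mono)
      finally show ?thesis by (simp add: L_def mult_ac)
    qed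
    show "1 / \<phi> (bdist D x) \<le> \<kappa> * (1 / \<phi> (bdist D y))" if "x \<in> cell P" "y \<in> cell Q" for x y
      using comparison[OF \<alpha> dP[OF that(1)] dQ[OF that(2)]] .
  qed (use cell_sets[OF P] cell_subset[OF P] cell_sets[OF QI] cell_subset[OF QI]
        D_sets bdist_pos pos p \<kappa> M_pos ak u inner
        weight_measurable[OF \<phi>_meas] m m_pos in \<open>auto simp: L_def \<theta>_def\<close>)
qed

end

lemma multiscale_cover_of_domain_condition:
  fixes \<mu> :: "'a::metric_space measure"
  assumes "domain_condition \<mu> D a \<gamma> d" "sets \<mu> = sets borel" "open D" "a > 0" "d > 0"
  obtains M J B V where "multiscale_cover \<mu> D a \<gamma> d M J B V"
  using assms(1) unfolding domain_condition_def
proof (elim exE conjE)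
  show thesis
    if "M > 0"
      "\<forall>n. \<forall>j\<in>J n. B n j \<in> sets \<mu> \<and> B n j \<subseteq> D"
      "D = (\<Union>n. \<Union>j\<in>J n. B n j)"
      "\<forall>x\<in>D. finite {(n, j). j \<in> J n \<and> x \<in> B n j} \<and>
        real (card {(n, j). j \<in> J n \<and> x \<in> B n j}) \<le> M"
      "\<forall>n. \<forall>j\<in>J n.
        (\<forall>x\<in>B n j. inverse M * a powi n \<le> bdist D x \<and> bdist D x \<le> M * a powi n) \<and>
        ennreal (inverse M * a powr (of_int n * d)) \<le> emeasure \<mu> (B n j) \<and>
        emeasure \<mu> (B n j) \<le> ennreal (M * a powr (of_int n * d))"
      "\<forall>n. \<forall>j\<in>J n. \<forall>k. of_int k > M \<longrightarrow>
        V n j k \<subseteq> J (n + k) \<and> finite (V n j k) \<and> V n j k \<noteq> {} \<and>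
        (\<forall>i\<in>V n j k.
          (SUP (x, y)\<in>B n j \<times> B (n + k) i. ennreal (dist x y))
            \<le> ennreal (if a < 1 then M * a powi n else M * a powi (n + k)))"
      "\<forall>n k. of_int k > M \<longrightarrow>
        (SUP i\<in>J (n + k).
            \<Sum>\<^sub>\<infinity>j\<in>{j \<in> J n. i \<in> V n j k}. ennreal (1 / real (card (V n j k))))
          \<le> ennreal (M * a powr (of_int k * \<gamma>))"
    for M :: real and J :: "int \<Rightarrow> nat set" and B :: "int \<Rightarrow> nat \<Rightarrow> 'a set"
      and V :: "int \<Rightarrow> nat \<Rightarrow> int \<Rightarrow> nat set"
  proof -
    have "multiscale_cover \<mu> D a \<gamma> d M J B V"
      using assms(2-5) that(1,3)
    proof unfold_locales
      fix n k :: int and j i :: nat and x :: 'a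
      show "j \<in> J n \<Longrightarrow> B n j \<in> sets \<mu> \<and> B n j \<subseteq> D"
        using that(2) by blast
      show "x \<in> D \<Longrightarrow> finite {(n, j). j \<in> J n \<and> x \<in> B n j} \<and>
          real (card {(n, j). j \<in> J n \<and> x \<in> B n j}) \<le> M"
        using that(4) by blast
      show "j \<in> J n \<Longrightarrow> x \<in> B n j \<Longrightarrow>
          inverse M * a powi n \<le> bdist D x \<and> bdist D x \<le> M * a powi n"
        using that(5) by blast
      show "j \<in> J n \<Longrightarrow>
          ennreal (inverse M * a powr (of_int n * d)) \<le> emeasure \<mu> (B n j) \<and>
          emeasure \<mu> (B n j) \<le> ennreal (M * a powr (of_int n * d))"
        using that(5) by blast
      show "j \<in> J n \<Longrightarrow> of_int k > M \<Longrightarrow>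
          V n j k \<subseteq> J (n + k) \<and> finite (V n j k) \<and> V n j k \<noteq> {}"
        using that(6) by blast
      show "j \<in> J n \<Longrightarrow> of_int k > M \<Longrightarrow> i \<in> V n j k \<Longrightarrow>
          (SUP (x, y)\<in>B n j \<times> B (n + k) i. ennreal (dist x y))
            \<le> ennreal (if a < 1 then M * a powi n else M * a powi (n + k))"
        using that(6) by blast
      show "of_int k > M \<Longrightarrow>
          (SUP i\<in>J (n + k). \<Sum>\<^sub>\<infinity>j\<in>{j \<in> J n. i \<in> V n j k}. ennreal (1 / real (card (V n j k))))
            \<le> ennreal (M * a powr (of_int k * \<gamma>))"
        using that(7) by blast
    qed
    then show thesis
      by (rule \<open>\<And>M J B V. multiscale_cover \<mu> D a \<gamma> d M J B V \<Longrightarrow> thesis\<close>)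
  qed
qed

section \<open>The Hardy inequality\<close>

theorem theorem5:
  fixes \<mu> :: "'a::metric_space measure"
    and D :: "'a set"
    and \<phi> :: "real \<Rightarrow> real"
    and \<gamma> \<eta> d a H p :: real
  assumes "sets \<mu> = sets borel"
    and "open D" and "D \<noteq> UNIV"
    and "d > 0" and "a > 0" and "a \<noteq> 1"
    and "domain_condition \<mu> D a \<gamma> d"
    and "\<And>s. s > 0 \<Longrightarrow> \<phi> s > 0"
    and "\<phi> \<in> borel_measurable (restrict_space borel {0<..})"
    and "0 < H" and "H \<le> 1"
    and "(a < 1 \<and> \<eta> + \<gamma> - d > 0 \<and> WLSC \<eta> H \<phi>) \<or>
         (a > 1 \<and> \<eta> + \<gamma> - d < 0 \<and> WUSC \<eta> (inverse H) \<phi>)"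
    and "p > 0"
  shows "\<exists>c>0. \<exists>R>0. \<forall>u :: 'a \<Rightarrow> real.
      u \<in> borel_measurable (restrict_space \<mu> D) \<longrightarrow>
      inner_int \<mu> D \<phi> d p R u \<in> borel_measurable (restrict_space \<mu> D) \<longrightarrow>
      (\<integral>\<^sup>+x\<in>D. ennreal (\<bar>u x\<bar> powr p / \<phi> (bdist D x)) \<partial>\<mu>) < \<infinity> \<longrightarrow>
      (\<integral>\<^sup>+x\<in>D. ennreal (\<bar>u x\<bar> powr p / \<phi> (bdist D x)) \<partial>\<mu>)
        \<le> ennreal c * (\<integral>\<^sup>+x\<in>D. inner_int \<mu> D \<phi> d p R u x \<partial>\<mu>)"
proof -
  obtain M J B V where "multiscale_cover \<mu> D a \<gamma> d M J B V"
    using multiscale_cover_of_domain_condition[of \<mu> D a \<gamma> d] assms by blast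
  then interpret multiscale_cover \<mu> D a \<gamma> d M J B V .
  show ?thesis
  proof (cases "D = {}")
    case True
    then show ?thesis
      by (simp add: gt_ex)
  next
    case False
    \<comment> \<open>\<open>\<kappa>\<close>: loss in the weight, \<open>\<theta>\<close>: ratio of the masses, \<open>K\<close>: load, for a jump by \<open>k\<close> scales;
      the exponents of \<open>a ^ k\<close> in their product add up to \<open>\<eta> + \<gamma> - d\<close>\<close>
    define E where "E = M powr (2 * \<bar>\<eta>\<bar>) / H"
    define \<kappa> where "\<kappa> k = E * (a ^ k) powr \<eta>" for k
    define \<theta> where "\<theta> k = M\<^sup>2 * (a ^ k) powr - d" for k
    define K where "K k = M * (a ^ k) powr \<gamma>" for k
    have E: "E > 0"
      using M_pos \<open>0 < H\<close> by (simp add: E_def)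
    have "a powr (\<eta> + \<gamma> - d) < 1"
    proof (cases "a < 1")
      case True
      then have "\<eta> + \<gamma> - d > 0" using assms(12) by auto
      then show ?thesis
        using powr_less_mono'[of a 0 "\<eta> + \<gamma> - d"] True \<open>a > 0\<close> by simp
    next
      case False
      then have "\<eta> + \<gamma> - d < 0" using assms(6,12) by auto
      then show ?thesis
        using powr_less_mono[of "\<eta> + \<gamma> - d" 0 a] False \<open>a \<noteq> 1\<close> by simp
    qed
    then have "(\<lambda>k. 2 powr p * E * M ^ 3 * (a powr (\<eta> + \<gamma> - d)) ^ k) \<longlonglongrightarrow> 2 powr p * E * M ^ 3 * 0"
      by (intro tendsto_intros LIMSEQ_power_zero) simp
    then have "\<forall>\<^sub>F k in sequentially. 2 powr p * E * M ^ 3 * (a powr (\<eta> + \<gamma> - d)) ^ k < 1 / 2"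
      by (rule order_tendstoD) simp
    moreover have eq: "2 powr p * \<kappa> k * \<theta> k * K k = 2 powr p * E * M ^ 3 * (a powr (\<eta> + \<gamma> - d)) ^ k" for k
    proof -
      have "(a powr (\<eta> + \<gamma> - d)) ^ k = (a ^ k) powr (\<eta> + \<gamma> - d)"
        using \<open>a > 0\<close> by (simp add: powr_powr mult.commute flip: powr_realpow)
      also have "\<dots> = (a ^ k) powr \<eta> * (a ^ k) powr - d * (a ^ k) powr \<gamma>"
        by (simp add: algebra_simps flip: powr_add)
      finally show ?thesis
        by (simp add: \<kappa>_def \<theta>_def K_def power2_eq_square power3_eq_cube)
    qed
    ultimately have small: "\<forall>\<^sub>F k in sequentially. 2 powr p * \<kappa> k * \<theta> k * K k < 1 / 2"
      by (simp only: eq)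
    have large: "\<forall>\<^sub>F k in sequentially. M < real k"
      by (rule filterlim_at_top_dense[THEN iffD1, OF filterlim_real_sequentially, rule_format])
    have scal: "(a < 1 \<and> WLSC \<eta> H \<phi>) \<or> (a > 1 \<and> WUSC \<eta> (inverse H) \<phi>)"
      using assms(12) by auto
    from eventually_happens'[OF _ eventually_conj[OF small eventually_conj[OF large
          scaling_comparison[OF \<open>a > 0\<close> \<open>a \<noteq> 1\<close> one_le_M[OF False] \<open>0 < H\<close> assms(8) scal]]]]
    obtain k where small: "2 powr p * \<kappa> k * \<theta> k * K k < 1 / 2" and large: "M < real k"
      and comparison: "\<And>b s r. b > 0 \<Longrightarrow> b / M \<le> s \<Longrightarrow> s \<le> M * b \<Longrightarrow>
        b * a ^ k / M \<le> r \<Longrightarrow> r \<le> M * (b * a ^ k) \<Longrightarrow> 1 / \<phi> s \<le> \<kappa> k * (1 / \<phi> r)"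
      by (auto simp: \<kappa>_def E_def)
    define L where "L = M powr d * M * (a ^ k) powr - d"
    define R where "R = M\<^sup>2 * max 1 (a ^ k) + 1"
    define c where "c = 2 * (2 powr p * L) * M"
    have c: "c > 0" and R: "R > 0" and L: "L > 0" and nonneg: "\<kappa> k \<ge> 0" "\<theta> k \<ge> 0" "K k \<ge> 0"
      using M_pos \<open>a > 0\<close> E by (auto simp: c_def R_def L_def \<kappa>_def \<theta>_def K_def intro!: add_nonneg_pos)

    show ?thesis
    proof (intro exI conjI allI impI)
      show "c > 0" "R > 0" by fact+
    next
      fix u :: "'a \<Rightarrow> real"
      assume u: "u \<in> borel_measurable (restrict_space \<mu> D)"
        and inner: "inner_int \<mu> D \<phi> d p R u \<in> borel_measurable (restrict_space \<mu> D)"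
        and finite: "(\<integral>\<^sup>+x\<in>D. ennreal (\<bar>u x\<bar> powr p / \<phi> (bdist D x)) \<partial>\<mu>) < \<infinity>"
      define w where "w x = ennreal (\<bar>u x\<bar> powr p / \<phi> (bdist D x))" for x
      define F where "F = inner_int \<mu> D \<phi> d p R u"
      define b where "b P = (\<integral>\<^sup>+x\<in>cell P. w x \<partial>\<mu>)" for P
      define h where "h P = ennreal (2 powr p * L) * (\<integral>\<^sup>+x\<in>cell P. F x \<partial>\<mu>)" for P
      let ?q = "ennreal (2 powr p * \<kappa> k * \<theta> k)"
      have w_meas: "w \<in> borel_measurable (restrict_space \<mu> D)"
        unfolding w_def using u weight_measurable[OF assms(9)] by measurable
      have step: "b P \<le> h P + ?q * b Q" if "P \<in> cell_indices" "Q \<in> targets k P" for P Q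
        unfolding b_def h_def w_def F_def L_def R_def \<theta>_def
        by (rule transport_step[OF large that \<open>p > 0\<close> nonneg(1) assms(8,9) comparison u
              inner[unfolded R_def]])
      let ?S = "\<integral>\<^sup>+P. b P \<partial>count_space cell_indices"
        and ?H = "\<integral>\<^sup>+P. h P \<partial>count_space cell_indices"
      note W_bounds = sum_set_nn_integral_bounds[OF w_meas D_sets countable_cell_indices
          cell_sets cell_cover cell_overlap, folded b_def]
      have "?S < \<infinity>"
        using W_bounds(2) finite by (auto simp: w_def ennreal_mult_less_top intro: le_less_trans)
      have "?S \<le> ?H + ?q * ennreal (K k) * ?S"
        by (rule sum_le_by_transport[OF countable_cell_indices targets_nonempty_finite[OF large]
              step targets_load[OF large, folded K_def]])
      also have "?q * ennreal (K k) * ?S = ennreal (2 powr p * \<kappa> k * \<theta> k * K k) * ?S"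
        using nonneg by (simp add: ennreal_mult)
      also have "\<dots> \<le> ennreal (1 / 2) * ?S"
        by (intro mult_right_mono ennreal_leI less_imp_le[OF small]) auto
      finally have "?S \<le> ?H + ennreal (1 / 2) * ?S"
        by (simp add: add_left_mono)
      with \<open>?S < \<infinity>\<close> have "?S \<le> 2 * ?H"
        by (intro ennreal_le_twice_of_le_add_half)
      also have "?H = ennreal (2 powr p * L) * (\<integral>\<^sup>+P. (\<integral>\<^sup>+x\<in>cell P. F x \<partial>\<mu>) \<partial>count_space cell_indices)"
        unfolding h_def by (rule nn_integral_cmult) auto
      also have "\<dots> \<le> ennreal (2 powr p * L) * (ennreal M * (\<integral>\<^sup>+x\<in>D. F x \<partial>\<mu>))"
        using sum_set_nn_integral_bounds(2)[OF inner D_sets countable_cell_indices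
            cell_sets cell_cover cell_overlap, folded F_def]
        by (intro mult_left_mono) auto
      also have "2 * (ennreal (2 powr p * L) * (ennreal M * (\<integral>\<^sup>+x\<in>D. F x \<partial>\<mu>)))
          = ennreal c * (\<integral>\<^sup>+x\<in>D. F x \<partial>\<mu>)"
        using L M_pos by (simp add: c_def ennreal_mult mult_ac)
      finally have "?S \<le> ennreal c * (\<integral>\<^sup>+x\<in>D. F x \<partial>\<mu>)"
        by (simp add: mult_left_mono)
      with W_bounds(1) show "(\<integral>\<^sup>+x\<in>D. ennreal (\<bar>u x\<bar> powr p / \<phi> (bdist D x)) \<partial>\<mu>)
          \<le> ennreal c * (\<integral>\<^sup>+x\<in>D. inner_int \<mu> D \<phi> d p R u x \<partial>\<mu>)"
        by (simp add: w_def F_def)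
    qed
  qed
qed

end
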